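(* (a) For each integer $\nu\ge0$, let $A(\nu)$ denote the number of $n$-colour self-inverse compositions of $2\nu+1$, and let $B(\nu)=\sum_{k=0}^{\nu}d_{\nu,k}$, where $d_{\nu,k}$ is the number of lattice paths from $(0,0)$ to $(2\nu+1-k,k)$ satisfying the following two conditions: the path does not have two vertical steps in succession (which ensures that it does not cross the line $y=x+1$); and the first and last steps of the path are not both vertical. Then $A(\nu)=B(\nu)$ for all $\nu\ge0$. (b) For every positive integer $\nu$, the number of $n$-colour self-inverse compositions of $2\nu$ equals three times the number of $n$-colour compositions of $\nu$.
   Context: An $n$-colour composition of a positive integer $N$ is a finite ordered sequence of coloured parts $(h_1)_{t_1}(h_2)_{t_2}\cdots(h_m)_{t_m}$ with each $h_i\ge 1$ an integer, $h_1+\cdots+h_m=N$, and each colour $t_i\in\{1,\dots,h_i\}$ (so a part of size $h$ comes in $h$ different colours). It is self-inverse if the sequence of coloured parts read from left to right is identical with the sequence read from right to left, i.e. $h_i=h_{m+1-i}$ and $t_i=t_{m+1-i}$ for all $i$. A lattice path from $(0,0)$ to $(p,r)$ (with $p,r$ non-negative integers) is a minimal path through points with non-negative integer coordinates taking unit horizontal and unit vertical steps, i.e. a sequence of $p+r$ steps consisting of $p$ steps $(1,0)$ (horizontal) and $r$ steps $(0,1)$ (vertical). *)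

theory Defs
  imports Main
begin

text \<open>A coloured part of size \<open>h\<close> and colour \<open>t\<close> is the pair \<open>(h, t)\<close>.\<close>

definition coloured_part :: "nat \<times> nat \<Rightarrow> bool" where
  "coloured_part p \<longleftrightarrow> 1 \<le> fst p \<and> 1 \<le> snd p \<and> snd p \<le> fst p"

definition n_colour_compositions :: "nat \<Rightarrow> (nat \<times> nat) list set" where
  "n_colour_compositions N =
     {c. (\<forall>p\<in>set c. coloured_part p) \<and> sum_list (map fst c) = N}"

definition self_inverse_compositions :: "nat \<Rightarrow> (nat \<times> nat) list set" where
  "self_inverse_compositions N = {c \<in> n_colour_compositions N. rev c = c}"

datatype step = Horizontal | Vertical

text \<open>A lattice path from the origin to \<open>(p, r)\<close> is given by its sequence of unit steps.\<close>

definition lattice_paths :: "nat \<Rightarrow> nat \<Rightarrow> step list set" where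
  "lattice_paths p r =
     {s. count_list s Horizontal = p \<and> count_list s Vertical = r}"

definition no_two_successive_vertical :: "step list \<Rightarrow> bool" where
  "no_two_successive_vertical s \<longleftrightarrow>
     (\<forall>i. Suc i < length s \<longrightarrow> \<not> (s ! i = Vertical \<and> s ! Suc i = Vertical))"

text \<open>Only used for nonempty paths, for which \<open>hd\<close> and \<open>last\<close> are meaningful.\<close>

definition ends_not_both_vertical :: "step list \<Rightarrow> bool" where
  "ends_not_both_vertical s \<longleftrightarrow> \<not> (hd s = Vertical \<and> last s = Vertical)"

definition d :: "nat \<Rightarrow> nat \<Rightarrow> nat" where
  "d \<nu> k = card {s \<in> lattice_paths (2 * \<nu> + 1 - k) k.
                    no_two_successive_vertical s \<and> ends_not_both_vertical s}"

definition A :: "nat \<Rightarrow> nat" where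
  "A \<nu> = card (self_inverse_compositions (2 * \<nu> + 1))"

definition B :: "nat \<Rightarrow> nat" where
  "B \<nu> = (\<Sum>k=0..\<nu>. d \<nu> k)"

text \<open>The sets counted above with \<open>card\<close> are finite, so no count is the default value \<open>0\<close>.\<close>

lemma finite_n_colour_compositions: "finite (n_colour_compositions N)"
proof (rule finite_subset)
  show "n_colour_compositions N \<subseteq>
          {c. set c \<subseteq> {..N} \<times> {..N} \<and> length c \<le> N}"
  proof
    fix c assume "c \<in> n_colour_compositions N"
    then have parts: "\<forall>p\<in>set c. coloured_part p" and total: "sum_list (map fst c) = N"
      by (auto simp: n_colour_compositions_def)
    have "fst p \<le> N" if "p \<in> set c" for p
      using that total member_le_sum_list[of "fst p" "map fst c"] by auto
    with parts have "set c \<subseteq> {..N} \<times> {..N}"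
      by (fastforce simp: coloured_part_def)
    moreover have "length c \<le> sum_list (map fst c)"
      using parts by (induction c) (auto simp: coloured_part_def)
    ultimately show "c \<in> {c. set c \<subseteq> {..N} \<times> {..N} \<and> length c \<le> N}"
      using total by simp
  qed
  show "finite {c. set c \<subseteq> {..N} \<times> {..N} \<and> length c \<le> N}"
    by (rule finite_lists_length_le) simp
qed

lemma finite_self_inverse_compositions: "finite (self_inverse_compositions N)"
  by (simp add: self_inverse_compositions_def finite_n_colour_compositions)

lemma length_lattice_path: "s \<in> lattice_paths p r \<Longrightarrow> length s = p + r"
proof -
  have "length s = count_list s Horizontal + count_list s Vertical"
  proof (induction s)
    case (Cons x s)
    then show ?case by (cases x) auto
  qed simp
  then show "s \<in> lattice_paths p r \<Longrightarrow> length s = p + r"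
    by (simp add: lattice_paths_def)
qed

lemma finite_lattice_paths: "finite (lattice_paths p r)"
proof (rule finite_subset)
  have "x \<in> {Horizontal, Vertical}" for x by (cases x) auto
  then show "lattice_paths p r \<subseteq> {s. set s \<subseteq> {Horizontal, Vertical} \<and> length s = p + r}"
    using length_lattice_path by blast
  show "finite {s. set s \<subseteq> {Horizontal, Vertical} \<and> length s = p + r}"
    by (rule finite_lists_length_eq) simp
qed

end

theory Submission
  imports Defs "HOL-Number_Theory.Fib"
begin

text \<open>
  Write \<open>c N\<close> for the number of \<open>n\<close>-colour compositions of \<open>N\<close>. A palindrome is determined by its
  first half \<open>u\<close>, a composition of some \<open>j\<close>, and by its central part, if it has one. The central
  part then has size \<open>N - 2j\<close>, and so \<open>N - 2j\<close> possible colours. Hence the number of palindromes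
  is \<open>\<Sum>j. (N - 2j) c j\<close>, plus \<open>c (N div 2)\<close> for those without a central part when \<open>N\<close> is even
  (\<open>card_self_inverse_compositions\<close>). Splitting off the first part of a composition gives
  \<open>c \<nu> = \<Sum>j. (\<nu> - j) c j\<close> for \<open>\<nu> \<ge> 1\<close> (\<open>num_comps_Suc\<close>). For \<open>N = 2\<nu>\<close> the sum over central parts is
  therefore \<open>2 c \<nu>\<close>, and the total is \<open>3 c \<nu>\<close>.

  For \<open>N = 2\<nu> + 1\<close> the same sum is \<open>2 \<Sum>j. (\<nu> - j) c j + \<Sum>j\<le>\<nu>. c j\<close>. The recurrence for \<open>c\<close> turns both
  terms into Fibonacci numbers (\<open>num_comps_fib\<close>), and the number of palindromes is the Lucas number
  \<open>fib (2\<nu>) + fib (2\<nu> + 2)\<close>.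

  On the other side, the paths counted by \<open>B \<nu>\<close> are, for all \<open>k\<close> together, exactly the words of
  length \<open>2\<nu> + 1\<close> in which no two vertical steps are adjacent when the word is closed up to a circle:
  adjacency on the circle already forces at most \<open>\<nu>\<close> vertical steps, so the bound \<open>k \<le> \<nu>\<close> excludes
  nothing (\<open>B_eq_card_cyclically_sparse_words\<close>). Linear words of length \<open>n\<close> without adjacent vertical
  steps are counted by \<open>fib (n + 2)\<close>. Cutting a circular word at its first step reduces
  it to a linear one, which gives the same Lucas number (\<open>card_cyclically_sparse_words\<close>).
\<close>

section \<open>Compositions\<close>

abbreviation num_comps :: "nat \<Rightarrow> nat" where
  "num_comps N \<equiv> card (n_colour_compositions N)"

lemma n_colour_compositions_append:
  "u @ v \<in> n_colour_compositions N \<longleftrightarrow>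
    (\<exists>i j. i + j = N \<and> u \<in> n_colour_compositions i \<and> v \<in> n_colour_compositions j)"
  by (auto simp: n_colour_compositions_def)

lemma n_colour_compositions_singleton:
  "[p] \<in> n_colour_compositions N \<longleftrightarrow> fst p = N \<and> snd p \<in> {1..N}"
  by (auto simp: n_colour_compositions_def coloured_part_def)

lemma total_rev: "sum_list (map fst (rev u)) = sum_list (map fst (u :: (nat \<times> nat) list))"
  by (induction u) auto

lemma n_colour_compositions_rev:
  "rev u \<in> n_colour_compositions N \<longleftrightarrow> u \<in> n_colour_compositions N"
  by (simp add: n_colour_compositions_def total_rev)

lemma n_colour_compositions_unique_total:
  "u \<in> n_colour_compositions i \<Longrightarrow> u \<in> n_colour_compositions j \<Longrightarrow> i = j"
  by (simp add: n_colour_compositions_def)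

lemma n_colour_compositions_0: "n_colour_compositions 0 = {[]}"
proof -
  have "c = []" if "c \<in> n_colour_compositions 0" for c
    using that by (cases c) (auto simp: n_colour_compositions_def coloured_part_def)
  then show ?thesis by (auto simp: n_colour_compositions_def)
qed

text \<open>The index \<open>j\<close> is what remains after the first part, whose size \<open>Suc n - j\<close> is also its number
  of colours.\<close>

lemma num_comps_Suc:
  "num_comps (Suc n) = (\<Sum>j\<le>n. (Suc n - j) * num_comps j)"
proof -
  let ?S = "SIGMA j:{..n}. {1..Suc n - j} \<times> n_colour_compositions j"
  let ?f = "\<lambda>(j, t, c). (Suc n - j, t) # c"
  have "bij_betw ?f ?S (n_colour_compositions (Suc n))"
  proof (rule bij_betw_imageI)
    show "inj_on ?f ?S"
      by (auto simp: inj_on_def dest: n_colour_compositions_unique_total)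
    show "?f ` ?S = n_colour_compositions (Suc n)"
    proof
      show "?f ` ?S \<subseteq> n_colour_compositions (Suc n)"
        by (auto simp: n_colour_compositions_def coloured_part_def)
      show "n_colour_compositions (Suc n) \<subseteq> ?f ` ?S"
      proof
        fix c assume c: "c \<in> n_colour_compositions (Suc n)"
        then obtain h t c' where [simp]: "c = (h, t) # c'"
          by (cases c) (auto simp: n_colour_compositions_def)
        let ?j = "Suc n - h"
        from c have "(?j, t, c') \<in> ?S" "h = Suc n - ?j"
          by (auto simp: n_colour_compositions_def coloured_part_def)
        then show "c \<in> ?f ` ?S" by (auto intro!: image_eqI[of _ _ "(?j, t, c')"])
      qed
    qed
  qed
  then have "num_comps (Suc n) = card ?S" by (simp add: bij_betw_same_card)
  then show ?thesis
    by (simp add: card_SigmaI finite_n_colour_compositions card_cartesian_product)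
qed

text \<open>Raising \<open>n\<close> by one in the convolution \<open>num_comps_Suc\<close> raises every weight by one, so the
  increments of \<open>num_comps\<close> are its partial sums. The values and the partial sums thus generate
  each other by addition, and interleave to the Fibonacci sequence.\<close>

lemma num_comps_fib:
  "num_comps (Suc n) = fib (2 * n + 2)" "(\<Sum>j\<le>n. num_comps j) = fib (2 * n + 1)"
proof -
  have step: "num_comps (Suc (Suc n)) = num_comps (Suc n) + (\<Sum>j\<le>Suc n. num_comps j)" for n
  proof -
    have "(\<Sum>j\<le>n. (Suc (Suc n) - j) * num_comps j)
        = (\<Sum>j\<le>n. (Suc n - j) * num_comps j + num_comps j)"
      by (intro sum.cong) (auto simp: Suc_diff_le)
    then show ?thesis
      by (simp only: num_comps_Suc sum.atMost_Suc[of _ n] sum.distrib)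
        (simp add: num_comps_Suc)
  qed
  have "num_comps (Suc n) = fib (2 * n + 2) \<and> (\<Sum>j\<le>n. num_comps j) = fib (2 * n + 1)"
  proof (induction n)
    case 0
    then show ?case
      by (simp add: num_comps_Suc n_colour_compositions_0 numeral_2_eq_2)
  next
    case (Suc n)
    then show ?case by (simp add: step)
  qed
  then show "num_comps (Suc n) = fib (2 * n + 2)" "(\<Sum>j\<le>n. num_comps j) = fib (2 * n + 1)"
    by auto
qed

section \<open>Palindromic compositions\<close>

text \<open>The cases are the two parities of the length: in the odd case the entry \<open>p\<close> in the middle
  is its own mirror image.\<close>

lemma palindrome_cases:
  assumes "rev c = c"
  obtains (even) u where "c = u @ rev u" | (odd) u p where "c = u @ [p] @ rev u"
proof (cases "even (length c)")
  case True
  let ?k = "length c div 2"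
  have "rev (take ?k c) = drop ?k c"
    using assms True by (metis add_diff_cancel_left' dvd_mult_div_cancel mult_2 rev_take)
  then show ?thesis using even[of "take ?k c"] by simp
next
  case False
  let ?k = "length c div 2"
  have len: "length c = Suc (?k + ?k)" using False by presburger
  then have "rev (take ?k c) = drop (Suc ?k) c"
    using assms by (metis add_Suc add_diff_cancel_right' rev_take)
  moreover have "c = take ?k c @ [c ! ?k] @ drop (Suc ?k) c"
    using len by (simp add: Cons_nth_drop_Suc)
  ultimately show ?thesis using odd[of "take ?k c" "c ! ?k"] by simp
qed

text \<open>The sum counts the palindromes of odd length by the total \<open>j\<close> of their first half; its term for
  \<open>2 * j = N\<close> vanishes, as it should, because a central part cannot be empty. The second summand
  counts the palindromes of even length.\<close>

lemma card_self_inverse_compositions: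
  "card (self_inverse_compositions N) =
    (\<Sum>j\<le>N div 2. (N - 2 * j) * num_comps j) + (if even N then num_comps (N div 2) else 0)"
proof -
  let ?S = "SIGMA j:{..N div 2}. {1..N - 2 * j} \<times> n_colour_compositions j"
  let ?f = "\<lambda>(j, t, u). u @ [(N - 2 * j, t)] @ rev u"
  let ?g = "\<lambda>u :: (nat \<times> nat) list. u @ rev u"
  let ?E = "if even N then n_colour_compositions (N div 2) else {}"
  have "self_inverse_compositions N = ?f ` ?S \<union> ?g ` ?E"
  proof (intro equalityI subsetI)
    fix c assume "c \<in> self_inverse_compositions N"
    then have c: "c \<in> n_colour_compositions N" "rev c = c"
      by (auto simp: self_inverse_compositions_def)
    from c(2) show "c \<in> ?f ` ?S \<union> ?g ` ?E"
    proof (cases rule: palindrome_cases)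
      case (even u)
      with c(1) obtain i where "u \<in> n_colour_compositions i" "i + i = N"
        by (auto simp: n_colour_compositions_append n_colour_compositions_rev
            dest: n_colour_compositions_unique_total)
      with even show ?thesis by auto
    next
      case (odd u p)
      obtain h t where p: "p = (h, t)" by fastforce
      have "u @ [(h, t)] @ rev u \<in> n_colour_compositions N" using c(1) odd p by simp
      then obtain i where u: "u \<in> n_colour_compositions i" "i + h + i = N" "t \<in> {1..h}"
        unfolding n_colour_compositions_append n_colour_compositions_singleton
          n_colour_compositions_rev
        by (auto dest: n_colour_compositions_unique_total)
      then have "(i, t, u) \<in> ?S" "h = N - 2 * i" by auto
      then have "c \<in> ?f ` ?S"
        unfolding odd p by (intro image_eqI[of _ _ "(i, t, u)"]) auto
      then show ?thesis ..
    qed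
  next
    fix c assume "c \<in> ?f ` ?S \<union> ?g ` ?E"
    then show "c \<in> self_inverse_compositions N"
    proof
      assume "c \<in> ?f ` ?S"
      then show ?thesis
        by (auto simp: self_inverse_compositions_def n_colour_compositions_def
            coloured_part_def total_rev)
    next
      assume "c \<in> ?g ` ?E"
      then show ?thesis
        by (auto simp: self_inverse_compositions_def n_colour_compositions_def
            total_rev split: if_splits)
    qed
  qed
  \<comment> \<open>The two kinds of palindrome are told apart by the parity of their length.\<close>
  moreover have "?f ` ?S \<inter> ?g ` ?E = {}"
  proof -
    have "odd (length c)" if "c \<in> ?f ` ?S" for c using that by auto
    moreover have "even (length c)" if "c \<in> ?g ` ?E" for c using that by auto
    ultimately show ?thesis by blast
  qed
  moreover have "inj_on ?f ?S"
  proof -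
    have "u = v \<and> p = q" if "u @ [p] @ rev u = v @ [q] @ rev v" for u v and p q :: "nat \<times> nat"
    proof -
      \<comment> \<open>Equal lengths align the two centres.\<close>
      from that have "length (u @ [p] @ rev u) = length (v @ [q] @ rev v)" by simp
      then have "length u = length v" by simp
      with that show ?thesis by simp
    qed
    note centre = this
    show ?thesis
    proof (rule inj_onI)
      fix x y assume xy: "x \<in> ?S" "y \<in> ?S" and eq: "?f x = ?f y"
      obtain i t u j t' v where [simp]: "x = (i, t, u)" "y = (j, t', v)"
        by (metis surj_pair)
      from eq have "u = v" "t = t'"
        using centre[of u "(N - 2 * i, t)" v "(N - 2 * j, t')"] by simp_all
      with xy show "x = y" by (auto dest: n_colour_compositions_unique_total)
    qed
  qed
  moreover have "inj_on ?g ?E"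
  proof (rule inj_onI)
    fix u v :: "(nat \<times> nat) list" assume eq: "u @ rev u = v @ rev v"
    then have "length (u @ rev u) = length (v @ rev v)" by simp
    then have "length u = length v" by simp
    with eq show "u = v" by simp
  qed
  moreover have "finite ?S" "finite ?E" by (auto simp: finite_n_colour_compositions)
  ultimately have "card (self_inverse_compositions N) = card ?S + card ?E"
    by (simp only: card_Un_disjoint card_image finite_imageI)
  then show ?thesis
    by (simp add: card_SigmaI finite_n_colour_compositions card_cartesian_product)
qed

lemma card_self_inverse_compositions_even:
  assumes "\<nu> \<ge> 1"
  shows "card (self_inverse_compositions (2 * \<nu>)) = 3 * num_comps \<nu>"
proof -
  obtain n where \<nu>: "\<nu> = Suc n" using assms by (cases \<nu>) auto
  have "(\<Sum>j\<le>\<nu>. (2 * \<nu> - 2 * j) * num_comps j) = 2 * (\<Sum>j\<le>n. (Suc n - j) * num_comps j)"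
    by (simp add: \<nu> sum_distrib_left mult.assoc[symmetric] diff_mult_distrib2)
  also have "\<dots> = 2 * num_comps \<nu>" by (simp add: \<nu> num_comps_Suc)
  finally show ?thesis by (simp add: card_self_inverse_compositions)
qed

lemma card_self_inverse_compositions_odd:
  "card (self_inverse_compositions (2 * \<nu> + 1)) = fib (2 * \<nu>) + fib (2 * \<nu> + 2)"
proof (cases \<nu>)
  case 0
  then show ?thesis by (simp add: card_self_inverse_compositions n_colour_compositions_0 numeral_2_eq_2)
next
  case (Suc n)
  have "(\<Sum>j\<le>\<nu>. (2 * \<nu> + 1 - 2 * j) * num_comps j)
      = (\<Sum>j\<le>\<nu>. (2 * (\<nu> - j) + 1) * num_comps j)"
    by (intro sum.cong) (auto simp: Suc_diff_le diff_mult_distrib2)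
  also have "\<dots> = 2 * (\<Sum>j\<le>\<nu>. (\<nu> - j) * num_comps j) + (\<Sum>j\<le>\<nu>. num_comps j)"
    by (simp add: sum.distrib sum_distrib_left add_mult_distrib mult.assoc)
  also have "(\<Sum>j\<le>\<nu>. (\<nu> - j) * num_comps j) = fib (2 * \<nu>)"
    using num_comps_Suc[of n] num_comps_fib(1)[of n] by (simp add: Suc)
  finally show ?thesis by (simp add: card_self_inverse_compositions num_comps_fib)
qed

section \<open>Lattice paths\<close>

lemma no_two_successive_vertical_iff_successively:
  "no_two_successive_vertical s \<longleftrightarrow>
    successively (\<lambda>x y. \<not> (x = Vertical \<and> y = Vertical)) s"
  by (auto simp: no_two_successive_vertical_def successively_conv_nth)

lemma no_two_successive_vertical_simps [simp]:
  "no_two_successive_vertical []"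
  "no_two_successive_vertical [x]"
  "no_two_successive_vertical (Horizontal # s) \<longleftrightarrow> no_two_successive_vertical s"
  "no_two_successive_vertical (Vertical # Horizontal # s) \<longleftrightarrow> no_two_successive_vertical s"
  "\<not> no_two_successive_vertical (Vertical # Vertical # s)"
  "no_two_successive_vertical (s @ [Horizontal]) \<longleftrightarrow> no_two_successive_vertical s"
  by (auto simp: no_two_successive_vertical_iff_successively successively_Cons
      successively_append_iff)

definition sparse_words :: "nat \<Rightarrow> step list set" where
  "sparse_words n = {s. length s = n \<and> no_two_successive_vertical s}"

lemma sparse_words_0: "sparse_words 0 = {[]}"
  by (auto simp: sparse_words_def)

lemma sparse_words_Suc_0: "sparse_words (Suc 0) = {[Horizontal], [Vertical]}"
proof -
  have "s = [Horizontal] \<or> s = [Vertical]" if "length s = Suc 0" for s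
    using that by (cases "hd s") (auto simp: length_Suc_conv)
  then show ?thesis by (auto simp: sparse_words_def)
qed

text \<open>A vertical first step forces the second one to be horizontal.\<close>

lemma sparse_words_Suc_Suc:
  "sparse_words (Suc (Suc n)) = (#) Horizontal ` sparse_words (Suc n)
     \<union> (\<lambda>s. Vertical # Horizontal # s) ` sparse_words n"
proof (intro equalityI subsetI)
  fix s assume s: "s \<in> sparse_words (Suc (Suc n))"
  then obtain x y s' where [simp]: "s = x # y # s'"
    by (auto simp: sparse_words_def length_Suc_conv)
  from s show "s \<in> (#) Horizontal ` sparse_words (Suc n)
     \<union> (\<lambda>s. Vertical # Horizontal # s) ` sparse_words n"
    by (cases x; cases y) (auto simp: sparse_words_def)
qed (auto simp: sparse_words_def)

lemma finite_sparse_words: "finite (sparse_words n)"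
  by (induction n rule: fib.induct)
    (simp_all add: sparse_words_0 sparse_words_Suc_0 sparse_words_Suc_Suc)

lemma card_sparse_words: "card (sparse_words n) = fib (n + 2)"
proof (induction n rule: fib.induct)
  case (3 n)
  have "card (sparse_words (Suc (Suc n))) = card (sparse_words (Suc n)) + card (sparse_words n)"
    unfolding sparse_words_Suc_Suc
    by (subst card_Un_disjoint) (auto simp: finite_sparse_words card_image inj_on_def)
  then show ?case using 3 by simp
qed (simp_all add: sparse_words_0 sparse_words_Suc_0 numeral_2_eq_2)

text \<open>Each vertical step, except possibly the last step of the path, is followed by a horizontal step
  of its own.\<close>

lemma count_Vertical_sparse:
  "no_two_successive_vertical s \<Longrightarrow> 2 * count_list s Vertical \<le> length s + 1"
proof (induction s rule: length_induct)
  case (1 s)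
  show ?case
  proof (cases s)
    case (Cons x s')
    show ?thesis
    proof (cases "x = Horizontal")
      case True
      then show ?thesis using 1 Cons by force
    next
      case False
      then have x: "x = Vertical" by (cases x) auto
      show ?thesis
      proof (cases s')
        case (Cons y s'')
        then show ?thesis using 1 x \<open>s = x # s'\<close> by (cases y) force+
      qed (use x Cons in auto)
    qed
  qed simp
qed

text \<open>One end of the path is horizontal; removing it absorbs the excess \<open>1\<close> of the linear bound.\<close>

lemma count_Vertical_cyclically_sparse:
  assumes "no_two_successive_vertical s" "ends_not_both_vertical s" "s \<noteq> []"
  shows "2 * count_list s Vertical \<le> length s"
proof (cases "hd s")
  case Horizontal
  with assms(3) have s: "s = Horizontal # tl s" by (cases s) auto
  with assms(1) have "no_two_successive_vertical (tl s)"
    by (metis no_two_successive_vertical_simps(3))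
  from count_Vertical_sparse[OF this] show ?thesis by (subst (1 2) s) simp
next
  case Vertical
  with assms(2) have "last s = Horizontal"
    by (cases "last s") (auto simp: ends_not_both_vertical_def)
  with assms(3) have s: "s = butlast s @ [Horizontal]" by (metis append_butlast_last_id)
  with assms(1) have "no_two_successive_vertical (butlast s)"
    by (metis no_two_successive_vertical_simps(6))
  from count_Vertical_sparse[OF this] show ?thesis by (subst (1 2) s) simp
qed

text \<open>For length \<open>1\<close> the vertical step counts as its own neighbour, and only the horizontal
  step remains.\<close>

definition cyclically_sparse_words :: "nat \<Rightarrow> step list set" where
  "cyclically_sparse_words n = {s \<in> sparse_words n. ends_not_both_vertical s}"

text \<open>The odd length \<open>2 * \<nu> + 1\<close> turns the bound of \<open>count_Vertical_cyclically_sparse\<close> into \<open>k \<le> \<nu>\<close>,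
  so the classes counted by \<open>d \<nu> k\<close> for \<open>k \<le> \<nu>\<close> already exhaust all cyclically sparse words.\<close>

lemma B_eq_card_cyclically_sparse_words: "B \<nu> = card (cyclically_sparse_words (2 * \<nu> + 1))"
proof -
  let ?D = "\<lambda>k. {s \<in> lattice_paths (2 * \<nu> + 1 - k) k.
    no_two_successive_vertical s \<and> ends_not_both_vertical s}"
  have "cyclically_sparse_words (2 * \<nu> + 1) = (\<Union>k\<in>{0..\<nu>}. ?D k)"
  proof (intro equalityI subsetI)
    fix s assume s: "s \<in> cyclically_sparse_words (2 * \<nu> + 1)"
    let ?k = "count_list s Vertical"
    from s have len: "length s = 2 * \<nu> + 1"
      by (simp add: cyclically_sparse_words_def sparse_words_def)
    then have "s \<noteq> []" by auto
    then have "2 * ?k \<le> length s"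
      using s count_Vertical_cyclically_sparse[of s]
      by (simp add: cyclically_sparse_words_def sparse_words_def)
    moreover have "s \<in> lattice_paths (count_list s Horizontal) ?k"
      by (simp add: lattice_paths_def)
    moreover from length_lattice_path[OF this] len
    have "count_list s Horizontal = 2 * \<nu> + 1 - ?k" by simp
    ultimately show "s \<in> (\<Union>k\<in>{0..\<nu>}. ?D k)"
      using s len by (auto simp: cyclically_sparse_words_def sparse_words_def intro!: bexI[of _ ?k])
  qed (auto simp: cyclically_sparse_words_def sparse_words_def length_lattice_path)
  moreover have "card (\<Union>k\<in>{0..\<nu>}. ?D k) = (\<Sum>k=0..\<nu>. card (?D k))"
  proof (rule card_UN_disjoint)
    show "\<forall>k\<in>{0..\<nu>}. finite (?D k)" by (simp add: finite_lattice_paths)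
    show "\<forall>i\<in>{0..\<nu>}. \<forall>j\<in>{0..\<nu>}. i \<noteq> j \<longrightarrow> ?D i \<inter> ?D j = {}"
      by (auto simp: lattice_paths_def)
  qed simp
  ultimately show ?thesis by (simp add: B_def d_def)
qed

text \<open>A horizontal first step cancels the circular condition; a vertical one forces both of its
  neighbours on the circle, the second and the last step, to be horizontal. These are distinct
  only from length \<open>3\<close> on.\<close>

lemma cyclically_sparse_words_split:
  "cyclically_sparse_words (Suc (Suc (Suc n))) = (#) Horizontal ` sparse_words (Suc (Suc n))
     \<union> (\<lambda>s. Vertical # Horizontal # s @ [Horizontal]) ` sparse_words n"
proof (intro equalityI subsetI)
  fix s assume s: "s \<in> cyclically_sparse_words (Suc (Suc (Suc n)))"
  then obtain x y s' where eq: "s = x # y # s'" "s' \<noteq> []"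
    by (auto simp: cyclically_sparse_words_def sparse_words_def length_Suc_conv)
  obtain s'' z where eq': "s' = s'' @ [z]" using eq(2) by (metis append_butlast_last_id)
  from s show "s \<in> (#) Horizontal ` sparse_words (Suc (Suc n))
     \<union> (\<lambda>s. Vertical # Horizontal # s @ [Horizontal]) ` sparse_words n"
    unfolding eq eq'
    by (cases x; cases y; cases z)
      (auto simp: cyclically_sparse_words_def sparse_words_def ends_not_both_vertical_def)
qed (auto simp: cyclically_sparse_words_def sparse_words_def ends_not_both_vertical_def)

lemma card_cyclically_sparse_words:
  "card (cyclically_sparse_words (Suc n)) = fib n + fib (n + 2)"
proof -
  consider "n = 0" | "n = 1" | m where "n = Suc (Suc m)"
    by (metis One_nat_def not0_implies_Suc)
  then show ?thesis
  proof cases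
    case 1
    have "cyclically_sparse_words (Suc 0) = {[Horizontal]}"
      unfolding cyclically_sparse_words_def sparse_words_Suc_0
      by (auto simp: ends_not_both_vertical_def)
    with 1 show ?thesis by (simp add: numeral_2_eq_2)
  next
    case 2
    have "cyclically_sparse_words (Suc (Suc 0)) =
        {[Horizontal, Horizontal], [Horizontal, Vertical], [Vertical, Horizontal]}"
      unfolding cyclically_sparse_words_def sparse_words_Suc_Suc sparse_words_Suc_0 sparse_words_0
      by (auto simp: ends_not_both_vertical_def)
    with 2 show ?thesis by (simp add: numeral_2_eq_2)
  next
    case (3 m)
    have "card (cyclically_sparse_words (Suc (Suc (Suc m))))
        = card (sparse_words (Suc (Suc m))) + card (sparse_words m)"
      unfolding cyclically_sparse_words_split
      by (subst card_Un_disjoint) (auto simp: finite_sparse_words card_image inj_on_def)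
    with 3 show ?thesis by (simp add: card_sparse_words)
  qed
qed

theorem theorem6p2:
  shows "(\<forall>\<nu>::nat. A \<nu> = B \<nu>) \<and>
    (\<forall>\<nu>::nat. \<nu> \<ge> 1 \<longrightarrow>
      card (self_inverse_compositions (2 * \<nu>)) = 3 * card (n_colour_compositions \<nu>))"
  using card_self_inverse_compositions_odd card_self_inverse_compositions_even
    card_cyclically_sparse_words
  by (simp add: A_def B_eq_card_cyclically_sparse_words)

end
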